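(* Let $\theta_0,\theta_\infty\in\mathbb{C}$ and let $q$ be a (not identically zero) meromorphic solution, on a connected open set $U\subset\mathbb{C}^*$, of the equation ${\rm PIII(D_6)}$ with parameters $(\theta_0,\theta_\infty)$: $$q''=\frac{(q')^2}{q}-\frac{q'}{t}-\frac{4(\theta_0-1)}{t}+\frac{4\theta_\infty q^2}{t}+4q^3-\frac4q.$$ Put $a=\frac{tq'+q}{4}$ and suppose that $-q^2t-\theta_0q-t+2a$ is not identically zero. Then $$\tilde q=\frac{q\,(-q^2t-\theta_\infty q-t+2a)}{-q^2t-\theta_0q-t+2a}$$ is a solution of ${\rm PIII(D_6)}$ with parameters $(\theta_\infty,\theta_0)$, i.e. $$\tilde q''=\frac{(\tilde q')^2}{\tilde q}-\frac{\tilde q'}{t}-\frac{4(\theta_\infty-1)}{t}+\frac{4\theta_0\tilde q^2}{t}+4\tilde q^3-\frac4{\tilde q},$$ provided $\tilde q$ is not identically zero.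
   Context: Here $'=\frac{d}{dt}$, and solutions are understood as meromorphic functions satisfying the equation as an identity of meromorphic functions. *)

theory Defs
  imports "HOL-Complex_Analysis.Complex_Analysis"
begin

text \<open>
  A meromorphic function is represented by a total function that is \<open>meromorphic_on\<close> \<open>U\<close>, whose
  values at a discrete set of points (in particular at poles) are irrelevant. Accordingly an
  identity of meromorphic functions on \<open>U\<close> is an identity outside a subset of \<open>U\<close> without
  accumulation points in \<open>U\<close>, i.e. \<open>\<forall>\<^sub>\<approx>t\<in>U\<close> (eventually in the filter \<open>cosparse U\<close>); the
  points where some \<open>deriv\<close> or quotient is not meaningful are discarded in this way.
\<close>

definition identically_zero_on :: "(complex \<Rightarrow> complex) \<Rightarrow> complex set \<Rightarrow> bool" where
  "identically_zero_on f U \<longleftrightarrow> (\<forall>\<^sub>\<approx>t\<in>U. f t = 0)"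

text \<open>
  The equation divides by \<open>q\<close>, so the zero function is not a solution; this has to be
  demanded explicitly because \<open>x / 0 = 0\<close>.
\<close>

definition PIII_D6_solution ::
    "complex \<Rightarrow> complex \<Rightarrow> complex set \<Rightarrow> (complex \<Rightarrow> complex) \<Rightarrow> bool" where
  "PIII_D6_solution \<theta>_0 \<theta>_inf U q \<longleftrightarrow>
     q meromorphic_on U \<and>
     \<not> identically_zero_on q U \<and>
     (\<forall>\<^sub>\<approx>t\<in>U. deriv (deriv q) t =
        (deriv q t)\<^sup>2 / q t - deriv q t / t - 4 * (\<theta>_0 - 1) / t
        + 4 * \<theta>_inf * (q t)\<^sup>2 / t + 4 * (q t) ^ 3 - 4 / q t)"

end

theory Submission
  imports Defs
begin

text \<open>
  Write the denominator as \<open>q * v\<close>. In terms of \<open>(q, v)\<close> the equation with parameters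
  \<open>(\<alpha>, \<beta>)\<close> is the first order system
  \<open>t q' = q (2 v + 2 \<alpha> - 1) + 2 t (1 + q\<^sup>2)\<close> and \<open>v' = 2 v / q - 2 q (v + \<alpha> - \<beta>)\<close>.
  The transformation becomes \<open>Q = q (v + \<alpha> - \<beta>) / v\<close>, \<open>V = v + \<alpha> - \<beta>\<close>, and it maps
  the system to the same system with \<open>\<alpha>\<close> and \<open>\<beta>\<close> interchanged: in the second equation the two
  terms on the right-hand side are separately invariant.
\<close>

text \<open>Here \<open>v\<close> is the first equation of the system solved for \<open>v\<close>,
  so that equation holds by construction. Only the second needs the Painleve equation: it removes
  the second derivative \<open>r\<close> from the derivative of \<open>v\<close>.\<close>

lemma PIII_D6_imp_system:
  fixes q p v :: "complex \<Rightarrow> complex" and \<alpha> \<beta> :: complex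
  defines "v \<equiv> \<lambda>t. (t * p t + q t) / (2 * q t) - t / q t - t * q t - \<alpha>"
  assumes q: "(q has_field_derivative p t) (at t)"
    and p: "(p has_field_derivative r) (at t)"
    and r: "r = (p t)\<^sup>2 / q t - p t / t - 4 * (\<alpha> - 1) / t + 4 * \<beta> * (q t)\<^sup>2 / t
              + 4 * (q t) ^ 3 - 4 / q t"
    and nz: "t \<noteq> 0" "q t \<noteq> 0"
  shows "(v has_field_derivative 2 * v t / q t - 2 * q t * (v t + \<alpha> - \<beta>)) (at t)"
proof -
  \<comment> \<open>The derivative of \<open>v\<close> contains \<open>r\<close> only in the product
    \<open>t * r\<close>, so the equation is used with the factor \<open>t\<close> cleared.\<close>
  have tr: "t * r = t * (p t)\<^sup>2 / q t - p t - 4 * (\<alpha> - 1) + 4 * \<beta> * (q t)\<^sup>2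
              + 4 * t * (q t) ^ 3 - 4 * t / q t"
    unfolding r using nz by (simp add: field_simps)
  have "(v has_field_derivative
           ((p t + t * r + p t) * (2 * q t) - (t * p t + q t) * (2 * p t)) / (2 * q t * (2 * q t))
           - (q t - t * p t) / (q t * q t) - (q t + t * p t)) (at t)"
    unfolding v_def using nz
    by (auto intro!: derivative_eq_intros q p simp: field_simps)
  also have "((p t + t * r + p t) * (2 * q t) - (t * p t + q t) * (2 * p t)) / (2 * q t * (2 * q t))
           - (q t - t * p t) / (q t * q t) - (q t + t * p t)
      = 2 * v t / q t - 2 * q t * (v t + \<alpha> - \<beta>)"
    unfolding tr v_def using nz by (simp add: field_simps) algebra
  finally show ?thesis .
qed

text \<open>Converse passage: differentiate the first equation, insert the second for the derivative
  of \<open>v\<close>, then eliminate \<open>v\<close>. The system is assumed on an open set because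
  the second derivative at \<open>t\<close> depends on \<open>deriv q\<close> near
  \<open>t\<close>.\<close>

lemma system_imp_PIII_D6:
  fixes q v :: "complex \<Rightarrow> complex"
  assumes G: "open G" "t \<in> G" "0 \<notin> G" and nz: "\<And>t. t \<in> G \<Longrightarrow> q t \<noteq> 0"
    and q: "\<And>t. t \<in> G \<Longrightarrow> (q has_field_derivative
              (q t * (2 * v t + 2 * \<alpha> - 1) + 2 * t * (1 + (q t)\<^sup>2)) / t) (at t)"
    and v: "\<And>t. t \<in> G \<Longrightarrow> (v has_field_derivative
              2 * v t / q t - 2 * q t * (v t + \<alpha> - \<beta>)) (at t)"
  shows "deriv (deriv q) t = (deriv q t)\<^sup>2 / q t - deriv q t / t - 4 * (\<alpha> - 1) / t
           + 4 * \<beta> * (q t)\<^sup>2 / t + 4 * (q t) ^ 3 - 4 / q t"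
proof -
  define p where "p t = (q t * (2 * v t + 2 * \<alpha> - 1) + 2 * t * (1 + (q t)\<^sup>2)) / t" for t
  have t: "t \<noteq> 0" "q t \<noteq> 0"
    using G nz by auto
  have dq: "deriv q s = p s" if "s \<in> G" for s
    using DERIV_imp_deriv[OF q[OF that]] by (simp add: p_def)
  have "((\<lambda>s. (q s * (2 * v s + 2 * \<alpha> - 1) + 2 * s * (1 + (q s)\<^sup>2)) / s) has_field_derivative
         (p t * (2 * v t + 2 * \<alpha> - 1) + q t * (2 * (2 * v t / q t - 2 * q t * (v t + \<alpha> - \<beta>)))
           + 2 * (1 + (q t)\<^sup>2) + 4 * t * q t * p t) / t - p t / t) (at t)"
    using t by (auto intro!: derivative_eq_intros q v G simp: p_def field_simps power2_eq_square)
  also have "(\<lambda>s. (q s * (2 * v s + 2 * \<alpha> - 1) + 2 * s * (1 + (q s)\<^sup>2)) / s) = p"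
    by (auto simp: p_def)
  finally have "deriv p t =
         (p t * (2 * v t + 2 * \<alpha> - 1) + q t * (2 * (2 * v t / q t - 2 * q t * (v t + \<alpha> - \<beta>)))
           + 2 * (1 + (q t)\<^sup>2) + 4 * t * q t * p t) / t - p t / t"
    by (rule DERIV_imp_deriv)
  also have "\<dots> = (p t)\<^sup>2 / q t - p t / t - 4 * (\<alpha> - 1) / t
           + 4 * \<beta> * (q t)\<^sup>2 / t + 4 * (q t) ^ 3 - 4 / q t"
  proof -
    \<comment> \<open>The first equation solved for \<open>v\<close> leaves an identity in
      \<open>t\<close>, \<open>q t\<close> and \<open>p t\<close> alone.\<close>
    have "2 * v t = (t * p t - 2 * t * (1 + (q t)\<^sup>2)) / q t - 2 * \<alpha> + 1"
      using t by (simp add: p_def field_simps)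
    hence v2: "v t = ((t * p t - 2 * t * (1 + (q t)\<^sup>2)) / q t - 2 * \<alpha> + 1) / 2"
      by (simp add: mult.commute)
    show ?thesis
      unfolding v2 using t by (simp add: field_simps) algebra
  qed
  also have "deriv p t = deriv (deriv q) t"
    by (rule deriv_cong_ev)
      (use G in \<open>auto intro: eventually_mono[OF eventually_nhds_in_open] simp: dq\<close>)
  finally show ?thesis
    using dq[OF G(2)] by simp
qed

text \<open>The whole symmetry rests on \<open>q * V = Q * v\<close> together with
  \<open>V + \<beta> - \<alpha> = v\<close>. The derivatives of \<open>v\<close> and
  \<open>V\<close> agree, since the two functions differ by a constant.\<close>

lemma system_swap_parameters:
  fixes q v Q V :: "complex \<Rightarrow> complex" and \<alpha> \<beta> :: complex
  defines "V \<equiv> \<lambda>t. v t + \<alpha> - \<beta>"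
  defines "Q \<equiv> \<lambda>t. q t * V t / v t"
  assumes q: "(q has_field_derivative
              (q t * (2 * v t + 2 * \<alpha> - 1) + 2 * t * (1 + (q t)\<^sup>2)) / t) (at t)"
    and v: "(v has_field_derivative 2 * v t / q t - 2 * q t * (v t + \<alpha> - \<beta>)) (at t)"
    and nz: "t \<noteq> 0" "q t \<noteq> 0" "v t \<noteq> 0" "V t \<noteq> 0"
  shows "(Q has_field_derivative
              (Q t * (2 * V t + 2 * \<beta> - 1) + 2 * t * (1 + (Q t)\<^sup>2)) / t) (at t)"
    and "(V has_field_derivative 2 * V t / Q t - 2 * Q t * (V t + \<beta> - \<alpha>)) (at t)"
proof -
  have v': "(v has_field_derivative 2 * v t / q t - 2 * q t * V t) (at t)"
    using v by (simp add: V_def)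
  have V': "(V has_field_derivative 2 * v t / q t - 2 * q t * V t) (at t)"
    unfolding V_def by (auto intro!: derivative_eq_intros v)
  \<comment> \<open>Termwise: \<open>v / q = V / Q\<close>, and \<open>q * V = Q * v\<close> with
    \<open>v = V + \<beta> - \<alpha>\<close>.\<close>
  also have "2 * v t / q t - 2 * q t * V t = 2 * V t / Q t - 2 * Q t * (V t + \<beta> - \<alpha>)"
    using nz by (simp add: Q_def field_simps) (simp add: V_def algebra_simps)
  finally show "(V has_field_derivative 2 * V t / Q t - 2 * Q t * (V t + \<beta> - \<alpha>)) (at t)" .
  define X where "X = q t * (2 * v t + 2 * \<alpha> - 1) + 2 * t * (1 + (q t)\<^sup>2)"
  have "(Q has_field_derivative
          ((X / t * V t + q t * (2 * v t / q t - 2 * q t * V t)) * v t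
             - q t * V t * (2 * v t / q t - 2 * q t * V t)) / (v t * v t)) (at t)"
    unfolding Q_def X_def using nz
    by (auto intro!: derivative_eq_intros q v' V' simp: algebra_simps)
  also have "((X / t * V t + q t * (2 * v t / q t - 2 * q t * V t)) * v t
             - q t * V t * (2 * v t / q t - 2 * q t * V t)) / (v t * v t)
      = (Q t * (2 * V t + 2 * \<beta> - 1) + 2 * t * (1 + (Q t)\<^sup>2)) / t"
  proof -
    \<comment> \<open>Eliminating \<open>\<alpha>\<close> instead of \<open>V\<close> keeps
      \<open>v t\<close> and \<open>V t\<close> as independent nonzero quantities, so that
      denominators clear to a polynomial identity.\<close>
    have \<alpha>: "\<alpha> = V t - v t + \<beta>"
      by (simp add: V_def)
    show ?thesis
      unfolding X_def \<alpha> Q_def using nz by (simp add: field_simps) algebra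
  qed
  finally show "(Q has_field_derivative
              (Q t * (2 * V t + 2 * \<beta> - 1) + 2 * t * (1 + (Q t)\<^sup>2)) / t) (at t)" .
qed

text \<open>This is where connectedness of \<open>U\<close> enters: by the identity theorem, a
  meromorphic function that is not identically zero vanishes at most on a sparse set.\<close>

lemma eventually_cosparse_nonzero:
  assumes "f meromorphic_on U" "open U" "connected U" "\<not> identically_zero_on f U"
  shows "\<forall>\<^sub>\<approx>t\<in>U. f t \<noteq> 0"
  using meromorphic_imp_constant_or_avoid[of f U 0] assms by (auto simp: identically_zero_on_def)

theorem mainTheorem8:
  fixes \<theta>_0 \<theta>_inf :: complex
    and U :: "complex set"
    and q a qt :: "complex \<Rightarrow> complex"
  assumes U: "open U" "connected U" "U \<subseteq> - {0}"
    and q: "PIII_D6_solution \<theta>_0 \<theta>_inf U q"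
    and a: "a = (\<lambda>t. (t * deriv q t + q t) / 4)"
    and denom: "\<not> identically_zero_on (\<lambda>t. - (q t)\<^sup>2 * t - \<theta>_0 * q t - t + 2 * a t) U"
    and qt: "qt = (\<lambda>t. q t * (- (q t)\<^sup>2 * t - \<theta>_inf * q t - t + 2 * a t)
                          / (- (q t)\<^sup>2 * t - \<theta>_0 * q t - t + 2 * a t))"
    and qt_nonzero: "\<not> identically_zero_on qt U"
  shows "PIII_D6_solution \<theta>_inf \<theta>_0 U qt"
proof -
  define D where "D = (\<lambda>t. - (q t)\<^sup>2 * t - \<theta>_0 * q t - t + 2 * a t)"
  define v where "v = (\<lambda>t. (t * deriv q t + q t) / (2 * q t) - t / q t - t * q t - \<theta>_0)"
  define V where "V = (\<lambda>t. v t + \<theta>_0 - \<theta>_inf)"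
  define Q where "Q = (\<lambda>t. q t * V t / v t)"
  have mero: "q meromorphic_on U"
    and ode: "\<forall>\<^sub>\<approx>t\<in>U. deriv (deriv q) t =
        (deriv q t)\<^sup>2 / q t - deriv q t / t - 4 * (\<theta>_0 - 1) / t
        + 4 * \<theta>_inf * (q t)\<^sup>2 / t + 4 * (q t) ^ 3 - 4 / q t"
    using q by (auto simp: PIII_D6_solution_def)
  have mero_D: "D meromorphic_on U"
    unfolding D_def a by (intro meromorphic_intros mero)
  have mero_qt: "qt meromorphic_on U"
    unfolding qt a by (intro meromorphic_intros mero)
  \<comment> \<open>At a good point all the pointwise calculations are legitimate. Nonvanishing of
    \<open>D\<close> gives that of \<open>v\<close>, and nonvanishing of \<open>qt\<close> gives
    that of \<open>V\<close>.\<close>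
  define good where "good t \<longleftrightarrow> t \<in> U \<and> q analytic_on {t} \<and> q t \<noteq> 0 \<and> D t \<noteq> 0 \<and> qt t \<noteq> 0 \<and>
      deriv (deriv q) t = (deriv q t)\<^sup>2 / q t - deriv q t / t - 4 * (\<theta>_0 - 1) / t
        + 4 * \<theta>_inf * (q t)\<^sup>2 / t + 4 * (q t) ^ 3 - 4 / q t" for t
  define G where "G = {t. good t}"
  have good: "\<forall>\<^sub>\<approx>t\<in>U. good t"
    unfolding good_def
    by (intro eventually_conj ode meromorphic_on_imp_analytic_cosparse mero
          eventually_cosparse_nonzero mero_D mero_qt U qt_nonzero eventually_in_cosparse order_refl)
      (use q denom in \<open>auto simp: PIII_D6_solution_def D_def\<close>)
  \<comment> \<open>The bad points are sparse in \<open>U\<close>, so removing them leaves an open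
    set, as the passage back to the second-order equation requires.\<close>
  have "open (U - {t. \<not> good t})"
    using good U(1) by (intro open_diff_sparse_pts) (auto simp: eventually_cosparse)
  also have "U - {t. \<not> good t} = G"
    by (auto simp: G_def good_def)
  finally have G: "open G" .
  have pt: "t \<noteq> 0" "q t \<noteq> 0" "v t \<noteq> 0" "V t \<noteq> 0" "qt t = Q t" "Q t \<noteq> 0"
    and dq: "(q has_field_derivative
              (q t * (2 * v t + 2 * \<theta>_0 - 1) + 2 * t * (1 + (q t)\<^sup>2)) / t) (at t)"
    and dv: "(v has_field_derivative 2 * v t / q t - 2 * q t * (v t + \<theta>_0 - \<theta>_inf)) (at t)"
    if "t \<in> G" for t
  proof -
    have t: "t \<in> U" "q analytic_on {t}" "q t \<noteq> 0" "D t \<noteq> 0" "qt t \<noteq> 0"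
      "deriv (deriv q) t = (deriv q t)\<^sup>2 / q t - deriv q t / t - 4 * (\<theta>_0 - 1) / t
        + 4 * \<theta>_inf * (q t)\<^sup>2 / t + 4 * (q t) ^ 3 - 4 / q t"
      using that by (auto simp: G_def good_def)
    show t0: "t \<noteq> 0" and q0: "q t \<noteq> 0"
      using t U by auto
    \<comment> \<open>Both numerator and denominator of \<open>qt\<close> carry a factor
      \<open>q\<close>; cancelling it turns \<open>qt\<close> into \<open>Q\<close>.\<close>
    have D: "D t = q t * v t" and
      E: "- (q t)\<^sup>2 * t - \<theta>_inf * q t - t + 2 * a t = q t * V t"
      using q0 by (simp_all add: D_def V_def v_def a field_simps power2_eq_square)
    show v0: "v t \<noteq> 0"
      using t D by auto
    have "qt t = q t * (- (q t)\<^sup>2 * t - \<theta>_inf * q t - t + 2 * a t) / D t"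
      by (simp add: qt D_def)
    thus qtQ: "qt t = Q t"
      unfolding D E Q_def using q0 by simp
    show "Q t \<noteq> 0" 
      using t qtQ by simp
    thus "V t \<noteq> 0"
      by (auto simp: Q_def)
    have q': "(q has_field_derivative deriv q t) (at t)"
      using t(2) by (simp add: analytic_on_imp_differentiable_at DERIV_deriv_iff_field_differentiable)
    have p': "(deriv q has_field_derivative deriv (deriv q) t) (at t)"
      using analytic_deriv[OF t(2)]
      by (simp add: analytic_on_imp_differentiable_at DERIV_deriv_iff_field_differentiable)
    have "deriv q t = (q t * (2 * v t + 2 * \<theta>_0 - 1) + 2 * t * (1 + (q t)\<^sup>2)) / t"
      using t0 q0 by (simp add: v_def field_simps power2_eq_square)
    thus "(q has_field_derivative
              (q t * (2 * v t + 2 * \<theta>_0 - 1) + 2 * t * (1 + (q t)\<^sup>2)) / t) (at t)"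
      using q' by simp
    show "(v has_field_derivative 2 * v t / q t - 2 * q t * (v t + \<theta>_0 - \<theta>_inf)) (at t)"
      unfolding v_def by (rule PIII_D6_imp_system[OF q' p' t(6) t0 q0])
  qed
  have dQ: "(Q has_field_derivative
              (Q t * (2 * V t + 2 * \<theta>_inf - 1) + 2 * t * (1 + (Q t)\<^sup>2)) / t) (at t)"
    and dV: "(V has_field_derivative 2 * V t / Q t - 2 * Q t * (V t + \<theta>_inf - \<theta>_0)) (at t)"
    if "t \<in> G" for t
    using system_swap_parameters[OF dq[OF that] dv[OF that]] pt[OF that]
    by (simp_all add: Q_def V_def)
  have "deriv (deriv qt) t =
        (deriv qt t)\<^sup>2 / qt t - deriv qt t / t - 4 * (\<theta>_inf - 1) / t
        + 4 * \<theta>_0 * (qt t)\<^sup>2 / t + 4 * (qt t) ^ 3 - 4 / qt t" if t: "t \<in> G" for t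
  proof (rule system_imp_PIII_D6[OF G t])
    show "0 \<notin> G"
      using pt(1) by blast
    fix s assume s: "s \<in> G"
    show "qt s \<noteq> 0"
      using pt[OF s] by simp
    show "(qt has_field_derivative
              (qt s * (2 * V s + 2 * \<theta>_inf - 1) + 2 * s * (1 + (qt s)\<^sup>2)) / s) (at s)"
      \<comment> \<open>\<open>qt\<close> and \<open>Q\<close> are only known to agree on
        \<open>G\<close>; since \<open>G\<close> is open, the derivative carries over.\<close>
      unfolding pt(5)[OF s]
      by (rule has_field_derivative_transform_within_open[OF dQ[OF s] G s]) (simp add: pt(5))
    show "(V has_field_derivative 2 * V s / qt s - 2 * qt s * (V s + \<theta>_inf - \<theta>_0)) (at s)"
      unfolding pt(5)[OF s] by (rule dV[OF s])
  qed
  with good have "\<forall>\<^sub>\<approx>t\<in>U. deriv (deriv qt) t =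
        (deriv qt t)\<^sup>2 / qt t - deriv qt t / t - 4 * (\<theta>_inf - 1) / t
        + 4 * \<theta>_0 * (qt t)\<^sup>2 / t + 4 * (qt t) ^ 3 - 4 / qt t"
    by (auto simp: G_def elim: eventually_mono)
  with mero_qt qt_nonzero show ?thesis
    by (simp add: PIII_D6_solution_def)
qed

end
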